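(* Let $l>0$ and let $k(t_i,t_j)=\sqrt{\pi}\,\exp\!\big(-\tfrac{(t_i-t_j)^2}{2l^2}\big)$ for $t_i,t_j\in\mathbb{R}$. Consider the Gauss–Hermite quadrature scheme of order $m$, and let $\bm\phi(t)\in\mathbb{R}^{2m}$ be the associated quadrature Fourier feature vector and $\bm\phi(t)'\in\mathbb{R}^{2m}$ its componentwise derivative with respect to $t$ (both defined in the context). Let $E_m:=\sqrt{\pi}\,\frac{1}{m^m}\big(\frac{e}{4l^2}\big)^m$, and let $E_{m-2}$, $E_{m-3}$ denote the same expression with $m$ replaced by $m-2$, $m-3$ respectively. Then, for $|t_i-t_j|\le 1$, it holds that (i) $\Big|\frac{\partial}{\partial t_i}k(t_i,t_j)-\bm\phi(t_i)'^{\,T}\bm\phi(t_j)\Big|\le \frac{2e}{l^2}\,E_{m-2}$; (ii) $\Big|\frac{\partial^2}{\partial t_i\partial t_j}k(t_i,t_j)-\bm\phi(t_i)'^{\,T}\bm\phi(t_j)'\Big|\le \frac{2e}{l^4}\,E_{m-3}$.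
   Context: Gauss–Hermite quadrature of order $m$: $Q_m(f)=\sum_{k=1}^m W_k^m f(\omega_k^m)$, where the abscissas $\omega_1^m,\dots,\omega_m^m$ are the zeros of the Hermite polynomial $H_m$ (orthogonal with respect to the weight $e^{-\omega^2}$ on $\mathbb{R}$) and the weights $W_k^m>0$ are the unique ones such that $Q_m(f)=\int_{-\infty}^{\infty}e^{-\omega^2}f(\omega)\,d\omega$ for all polynomials $f$ of degree at most $2m-1$. Feature vector: for $t\in\mathbb{R}$, $\bm\phi(t)\in\mathbb{R}^{2m}$ consists, for each $k=1,\dots,m$, of the two components $\sqrt{W_k^m}\cos\!\big(\omega_k^m\tfrac{\sqrt2}{l}t\big)$ and $\sqrt{W_k^m}\sin\!\big(\omega_k^m\tfrac{\sqrt2}{l}t\big)$. Its derivative $\bm\phi(t)'$ consists, correspondingly, of $-\sqrt{W_k^m}\tfrac{\sqrt2}{l}\omega_k^m\sin\!\big(\omega_k^m\tfrac{\sqrt2}{l}t\big)$ and $\sqrt{W_k^m}\tfrac{\sqrt2}{l}\omega_k^m\cos\!\big(\omega_k^m\tfrac{\sqrt2}{l}t\big)$.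
   Formalization: Part (i) is stated for m ≥ 2 and part (ii) for m ≥ 3, with E_0 = √π (0^0 = 1), because for smaller m the index of E is negative and the bounds fail (for instance E_{-1} < 0). *)

theory Defs
  imports "HOL-Probability.Probability" "Jordan_Normal_Form.Matrix"
begin

text \<open>
  Gauss--Hermite quadrature for the weight \<open>exp (- x\<^sup>2)\<close>, and the Fourier features it induces for the
  kernel \<open>sqrt pi * exp (- (s - t)\<^sup>2 / (2 * l\<^sup>2))\<close>. Abscissas, weights and vector components are
  indexed from 0.
\<close>

text \<open>
  Physicists' normalisation, i.e. leading coefficient \<open>2 ^ n\<close>; see \<open>hermite_degree\<close> and
  \<open>hermite_orthogonal\<close> below.
\<close>

fun hermite :: "nat \<Rightarrow> real poly" where
  "hermite 0 = 1"
| "hermite (Suc 0) = [:0, 2:]"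
| "hermite (Suc (Suc n)) = [:0, 2:] * hermite (Suc n) - Polynomial.smult (2 * real (Suc n)) (hermite n)"

definition quad :: "nat \<Rightarrow> (nat \<Rightarrow> real) \<Rightarrow> (nat \<Rightarrow> real) \<Rightarrow> (real \<Rightarrow> real) \<Rightarrow> real" where
  "quad m \<omega> W f = (\<Sum>k<m. W k * f (\<omega> k))"

text \<open>
  The numbering of the zeros is left open. The last clause determines \<open>W\<close> on \<open>{..<m}\<close>;
  the integrals in it always exist, see \<open>integrable_gauss_poly\<close>.
\<close>

definition gauss_hermite :: "nat \<Rightarrow> (nat \<Rightarrow> real) \<Rightarrow> (nat \<Rightarrow> real) \<Rightarrow> bool" where
  "gauss_hermite m \<omega> W \<longleftrightarrow>
     bij_betw \<omega> {..<m} {x. poly (hermite m) x = 0} \<and>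
     (\<forall>k<m. W k > 0) \<and>
     (\<forall>p. degree p \<le> 2 * m - 1 \<longrightarrow>
        quad m \<omega> W (poly p) = (LINT x|lborel. exp (- x\<^sup>2) * poly p x))"

definition kern :: "real \<Rightarrow> real \<Rightarrow> real \<Rightarrow> real" where
  "kern l s t = sqrt pi * exp (- (s - t)\<^sup>2 / (2 * l\<^sup>2))"

definition qff :: "nat \<Rightarrow> (nat \<Rightarrow> real) \<Rightarrow> (nat \<Rightarrow> real) \<Rightarrow> real \<Rightarrow> real \<Rightarrow> real vec" where
  "qff m \<omega> W l t = vec (2 * m) (\<lambda>i.
     if even i then sqrt (W (i div 2)) * cos (\<omega> (i div 2) * (sqrt 2 / l) * t)
     else sqrt (W (i div 2)) * sin (\<omega> (i div 2) * (sqrt 2 / l) * t))"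

definition qff_deriv :: "nat \<Rightarrow> (nat \<Rightarrow> real) \<Rightarrow> (nat \<Rightarrow> real) \<Rightarrow> real \<Rightarrow> real \<Rightarrow> real vec" where
  "qff_deriv m \<omega> W l t = vec (2 * m) (\<lambda>i. deriv (\<lambda>s. vec_index (qff m \<omega> W l s) i) t)"

text \<open>The term \<open>real n ^ n\<close> is 1 for \<open>n = 0\<close>.\<close>

definition err :: "real \<Rightarrow> nat \<Rightarrow> real" where
  "err l n = sqrt pi * (1 / real n ^ n) * (exp 1 / (4 * l\<^sup>2)) ^ n"


lemma qff_deriv_eq:
  "qff_deriv m \<omega> W l t = vec (2 * m) (\<lambda>i.
     if even i then - sqrt (W (i div 2)) * (sqrt 2 / l) * \<omega> (i div 2) * sin (\<omega> (i div 2) * (sqrt 2 / l) * t)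
     else sqrt (W (i div 2)) * (sqrt 2 / l) * \<omega> (i div 2) * cos (\<omega> (i div 2) * (sqrt 2 / l) * t))"
proof -
  have "((\<lambda>s. w * cos (a * c * s)) has_field_derivative - w * c * a * sin (a * c * t)) (at t)"
    "((\<lambda>s. w * sin (a * c * s)) has_field_derivative w * c * a * cos (a * c * t)) (at t)"
    for w a c :: real
    by (auto intro!: derivative_eq_intros)
  note d = this[THEN DERIV_imp_deriv]
  show ?thesis
    unfolding qff_deriv_def by (rule eq_vecI) (auto simp: qff_def d simp del: times_divide_eq_right times_divide_eq_left)
qed

lemma hermite_degree: "degree (hermite n) = n \<and> lead_coeff (hermite n) = 2 ^ n"
proof (induction n rule: hermite.induct)
  case (3 n)
  let ?h = "[:0, 2:] * hermite (Suc n)" and ?g = "Polynomial.smult (2 * real (Suc n)) (hermite n)"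
  have nz: "hermite (Suc n) \<noteq> 0"
    using 3 by auto
  have d: "degree ?h = Suc (Suc n)"
    using 3 nz by (subst degree_mult_eq) auto
  have l: "degree (- ?g) < degree ?h"
    unfolding d using 3 by simp
  have e: "hermite (Suc (Suc n)) = ?h + - ?g"
    by simp
  have dd: "degree (hermite (Suc (Suc n))) = Suc (Suc n)"
    unfolding e using degree_add_eq_left[OF l] d by metis
  have "coeff ?g (Suc (Suc n)) = 0"
    using l d by (intro coeff_eq_0) simp
  then have "lead_coeff (hermite (Suc (Suc n))) = lead_coeff ?h"
    unfolding dd d by simp
  also have "\<dots> = 2 ^ Suc (Suc n)"
    using conjunct2[OF 3(1)] unfolding lead_coeff_mult by (simp only:) simp
  finally show ?case
    using dd by simp
qed auto

lemma gauss_moment_even: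
  "has_bochner_integral lborel (\<lambda>x::real. exp (- x\<^sup>2) * x ^ (2 * k))
     (sqrt pi * (fact (2 * k) / (2 ^ (2 * k) * fact k)))"
  using has_bochner_integral_even_function[OF gaussian_moment_even_pos[where k = k]] by simp

lemma gauss_moment_odd:
  "has_bochner_integral lborel (\<lambda>x::real. exp (- x\<^sup>2) * x ^ (2 * k + 1)) 0"
  using has_bochner_integral_odd_function[OF gaussian_moment_odd_pos[where k = k]] by simp

lemma integrable_gauss_power: "integrable lborel (\<lambda>x::real. exp (- x\<^sup>2) * x ^ n)"
  using gauss_moment_even[of "n div 2"] gauss_moment_odd[of "n div 2"]
  by (cases "even n") (auto simp: has_bochner_integral_iff elim!: evenE oddE)

lemma integrable_gauss_poly: "integrable lborel (\<lambda>x::real. exp (- x\<^sup>2) * poly p x)"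
proof -
  have "integrable lborel (\<lambda>x::real. \<Sum>i\<le>degree p. coeff p i * (exp (- x\<^sup>2) * x ^ i))"
    by (intro Bochner_Integration.integrable_sum integrable_mult_right integrable_gauss_power)
  then show ?thesis
    by (simp add: poly_altdef sum_distrib_left mult_ac)
qed

lemma gauss_integral_poly_parts:
  fixes p :: "real poly"
  shows "(LINT x|lborel. exp (- x\<^sup>2) * poly ([:0, 2:] * p) x) =
   (LINT x|lborel. exp (- x\<^sup>2) * poly (pderiv p) x)"
proof -
  define L where "L p = (LINT x|lborel. exp (- x\<^sup>2) * poly p x)" for p :: "real poly"
  have add: "L (p + q) = L p + L q" for p q
    unfolding L_def by (simp add: distrib_left integrable_gauss_poly Bochner_Integration.integral_add)
  have smult: "L (Polynomial.smult c p) = c * L p" for c p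
    unfolding L_def by (simp add: mult.left_commute[of _ c])
  have L0: "L 0 = 0"
    by (simp add: L_def)
  have even: "L (monom 1 (2 * k)) = sqrt pi * (fact (2 * k) / (2 ^ (2 * k) * fact k))" for k
    using gauss_moment_even[of k] by (simp add: L_def poly_monom has_bochner_integral_iff)
  have odd: "L (monom 1 (2 * k + 1)) = 0" for k
    using gauss_moment_odd[of k] by (simp add: L_def poly_monom has_bochner_integral_iff)
  have mon: "L ([:0, 2:] * monom 1 n) = L (pderiv (monom 1 n))" for n
  proof -
    have lhs: "L ([:0, 2:] * monom 1 n) = 2 * L (monom 1 (Suc n))"
      by (simp add: smult[symmetric] monom_Suc)
    have rhs: "L (pderiv (monom 1 n)) = real n * L (monom 1 (n - 1))"
      by (simp add: smult[symmetric] pderiv_monom smult_monom)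
    show ?thesis
    proof (cases "even n")
      case True
      then obtain k where k: "n = 2 * k" by (elim evenE)
      have "L (monom 1 (Suc n)) = 0"
        using odd[of k] k by simp
      moreover have "real n * L (monom 1 (n - 1)) = 0"
        using odd[of "k - 1"] k by (cases k) auto
      ultimately show ?thesis using lhs rhs by simp
    next
      case False
      then obtain k where k: "n = 2 * k + 1" by (elim oddE)
      have "2 * L (monom 1 (2 * Suc k)) = (2 * real k + 1) * L (monom 1 (2 * k))"
        unfolding even by (simp add: divide_simps)
      then show ?thesis
        unfolding lhs rhs by (simp add: k)
    qed
  qed
  have "L ([:0, 2:] * p) = L (pderiv p)"
  proof -
    have eq: "p = (\<Sum>i\<le>degree p. Polynomial.smult (coeff p i) (monom 1 i))"
      by (simp add: poly_as_sum_of_monoms smult_monom)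
    have sum: "L (\<Sum>i\<in>A. f i) = (\<Sum>i\<in>A. L (f i))" for A and f :: "nat \<Rightarrow> real poly"
      by (induction A rule: infinite_finite_induct) (auto simp: add L0)
    have pderiv_sum: "pderiv (\<Sum>i\<in>A. f i) = (\<Sum>i\<in>A. pderiv (f i))"
      for A and f :: "nat \<Rightarrow> real poly"
      by (induction A rule: infinite_finite_induct) (auto simp: pderiv_add)
    show ?thesis
      by (subst (1 2) eq)
        (simp only: sum_distrib_left pderiv_sum pderiv_smult mult_smult_right sum smult mon)
  qed
  then show ?thesis
    by (simp only: L_def)
qed

lemma pderiv_hermite: "pderiv (hermite (Suc n)) = Polynomial.smult (2 * real (Suc n)) (hermite n)"
proof (induction n rule: less_induct)
  case (less n)
  show ?case
  proof (cases n)
    case 0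
    then show ?thesis by (simp add: pderiv_pCons one_pCons)
  next
    case (Suc k)
    let ?X = "[:0, 2:] :: real poly" and ?c = "2 * real (Suc k)"
    have H: "hermite (Suc k) = ?X * hermite k - pderiv (hermite k)"
      using less[of "k - 1"] Suc by (cases k) (auto simp: pderiv_1)
    have "pderiv (hermite (Suc n)) =
        ?X * pderiv (hermite (Suc k)) + pderiv ?X * hermite (Suc k) - Polynomial.smult ?c (pderiv (hermite k))"
      unfolding Suc hermite.simps(3) pderiv_diff pderiv_mult pderiv_smult by (simp only: mult.commute)
    also have "pderiv (hermite (Suc k)) = Polynomial.smult ?c (hermite k)"
      using less[of k] Suc by simp
    also have "pderiv ?X * hermite (Suc k) = Polynomial.smult 2 (hermite (Suc k))"
      by (simp add: pderiv_pCons)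
    also have "?X * Polynomial.smult ?c (hermite k) + Polynomial.smult 2 (hermite (Suc k)) -
        Polynomial.smult ?c (pderiv (hermite k)) =
        Polynomial.smult ?c (?X * hermite k - pderiv (hermite k)) + Polynomial.smult 2 (hermite (Suc k))"
      by (simp only: smult_diff_right mult_smult_right)
    also have "\<dots> = Polynomial.smult (2 * real (Suc n)) (hermite n)"
      unfolding H[symmetric] Suc smult_add_left[symmetric] by simp
    finally show ?thesis .
  qed
qed

lemma hermite_orthogonal:
  assumes "degree q < n"
  shows "(LINT x|lborel. exp (- x\<^sup>2) * (poly (hermite n) x * poly q x)) = 0"
  using assms
proof (induction n arbitrary: q)
  case (Suc n)
  define L where "L p = (LINT x|lborel. exp (- x\<^sup>2) * poly p x)" for p :: "real poly"
  have add: "L (p + q) = L p + L q" for p q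
    unfolding L_def by (simp add: distrib_left integrable_gauss_poly Bochner_Integration.integral_add)
  have step: "hermite (Suc n) = [:0, 2:] * hermite n - pderiv (hermite n)"
    using pderiv_hermite[of "n - 1"] by (cases n) (auto simp: pderiv_1)
  have "L (hermite (Suc n) * q) + L (pderiv (hermite n) * q) = L ([:0, 2:] * (hermite n * q))"
    unfolding step add[symmetric] by (simp only: algebra_simps) simp
  also have "\<dots> = L (pderiv (hermite n * q))"
    unfolding L_def by (rule gauss_integral_poly_parts)
  also have "\<dots> = L (hermite n * pderiv q) + L (pderiv (hermite n) * q)"
    unfolding add[symmetric] by (simp add: pderiv_mult mult.commute add.commute)
  finally have "L (hermite (Suc n) * q) = L (hermite n * pderiv q)"
    by simp
  also have "\<dots> = 0"
  proof (cases "degree q = 0")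
    case True
    then have "pderiv q = 0" by (simp add: pderiv_eq_0_iff)
    then show ?thesis by (simp add: L_def)
  next
    case False
    then have "degree (pderiv q) < n"
      using Suc.prems by (simp add: degree_pderiv)
    from Suc.IH[OF this] show ?thesis by (simp add: L_def)
  qed
  finally show ?case
    by (simp add: L_def del: hermite.simps)
qed simp

end

theory Submission
  imports Defs
begin

text \<open>
  With \<open>c = sqrt 2 / l\<close> and \<open>a = c * (s - t)\<close>, both errors are (up to the factors \<open>- c\<close> and \<open>c\<^sup>2\<close>) errors of
  the quadrature rule: on \<open>x * sin (a * x)\<close> for the first derivative and on \<open>x\<^sup>2 * cos (a * x)\<close> for the
  mixed one. Put \<open>n = m - 1\<close>. Subtract from \<open>sin\<close> its interpolant at the zeros of the product of the
  Hermite polynomials of degrees \<open>n\<close> and \<open>n - 1\<close>, and from \<open>cos\<close> its interpolant at the doubled zeros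
  of the one of degree \<open>n - 1\<close>. The remainders are dominated by nonnegative polynomials of degree at
  most \<open>2 * m - 1\<close>, on which the quadrature is exact, so the error is at most twice the Gaussian
  integral of such a polynomial; orthogonality evaluates it. Interpolating at fewer than \<open>2 * m\<close> points
  yields the power \<open>l ^ (2 * n)\<close> in the denominator that the claimed bounds require for small \<open>l\<close>.
\<close>

section \<open>Newton interpolation with an explicit error bound\<close>

text \<open>The divided difference of \<open>g 0\<close> at \<open>y\<close> is the integral of
  \<open>g 1 (y + s * (x - y))\<close> over \<open>s\<close> in [0,1], which stays smooth at
  \<open>x = y\<close>. Differentiating \<open>k\<close> times under the integral produces a factor
  \<open>s ^ k\<close>, whose integral is the \<open>1 / real (Suc k)\<close> of the bound. Carrying
  the whole sequence of derivatives allows the construction to be repeated for the next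
  node.\<close>

lemma divided_difference_smooth:
  fixes g :: "nat \<Rightarrow> real \<Rightarrow> real"
  assumes deriv: "\<And>k x. (g k has_real_derivative g (Suc k) x) (at x)"
    and bound: "\<And>k x. \<bar>g k x\<bar> \<le> B k"
  obtains G :: "nat \<Rightarrow> real \<Rightarrow> real"
  where "\<And>k x. (G k has_real_derivative G (Suc k) x) (at x)"
    and "\<And>k x. \<bar>G k x\<bar> \<le> B (Suc k) / real (Suc k)"
    and "\<And>x. g 0 x = g 0 y + (x - y) * G 0 x"
proof -
  define F where "F k x s = s ^ k * g (Suc k) (y + s * (x - y))" for k and x s :: real
  define G where "G k x = integral (cbox 0 1) (F k x)" for k x
  have cont_g: "continuous_on A (g k)" for A k
    using deriv DERIV_isCont continuous_at_imp_continuous_on by blast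
  have cont_F: "continuous_on A (F k x)" for A k x
    unfolding F_def by (intro continuous_intros continuous_on_compose2[OF cont_g[of UNIV]]) auto
  have F_int: "F k x integrable_on {0..1}" for k x
    using cont_F by (rule integrable_continuous_real)
  have "(G k has_real_derivative G (Suc k) x) (at x)" for k x
    unfolding G_def
  proof (rule leibniz_rule_field_derivative[where U = UNIV])
    show "((\<lambda>x. F k x s) has_real_derivative F (Suc k) x s) (at x)" for x s
      unfolding F_def
      by (rule derivative_eq_intros DERIV_chain2[OF deriv] refl | simp)+
    show "continuous_on (UNIV \<times> cbox 0 1) (\<lambda>(x, s). F (Suc k) x s)"
      unfolding F_def split_beta
      by (intro continuous_intros continuous_on_compose2[OF cont_g[of UNIV]]) auto
  qed (use F_int in auto)
  moreover have "\<bar>G k x\<bar> \<le> B (Suc k) / real (Suc k)" for k x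
  proof -
    have "((\<lambda>s. B (Suc k) * s ^ k) has_integral
        B (Suc k) * (1 ^ Suc k / real (Suc k)) - B (Suc k) * (0 ^ Suc k / real (Suc k))) {0..1}"
      by (rule fundamental_theorem_of_calculus)
        (auto simp: has_real_derivative_iff_has_vector_derivative[symmetric] simp del: power_Suc
          intro!: derivative_eq_intros)
    then have *: "((\<lambda>s. B (Suc k) * s ^ k) has_integral B (Suc k) / real (Suc k)) (cbox 0 1)"
      by simp
    have "norm (integral (cbox 0 1) (F k x)) \<le> integral (cbox 0 1) (\<lambda>s. B (Suc k) * s ^ k)"
      using F_int * by (intro integral_norm_bound_integral)
        (auto simp: F_def abs_mult mult.commute[of "B (Suc k)"] intro!: mult_left_mono bound)
    then show ?thesis
      unfolding G_def integral_unique[OF *] by simp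
  qed
  \<comment> \<open>Fundamental theorem of calculus along the segment from \<open>y\<close> to
    \<open>x\<close>.\<close>
  moreover have "g 0 x = g 0 y + (x - y) * G 0 x" for x
  proof -
    have line: "((\<lambda>s. y + s * (x - y)) has_real_derivative x - y) (at s within {0..1})" for s
      by (auto intro!: derivative_eq_intros)
    have "((\<lambda>s. g 0 (y + s * (x - y))) has_real_derivative (x - y) * F 0 x s) (at s within {0..1})" for s
      using DERIV_chain2[OF deriv[of 0 "y + s * (x - y)"] line[of s]] by (simp add: F_def mult.commute)
    then have "((\<lambda>s. (x - y) * F 0 x s) has_integral g 0 (y + 1 * (x - y)) - g 0 (y + 0 * (x - y))) {0..1}"
      by (intro fundamental_theorem_of_calculus)
        (auto simp: has_real_derivative_iff_has_vector_derivative[symmetric])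
    from integral_unique[OF this] show ?thesis
      by (simp add: G_def)
  qed
  ultimately show ?thesis using that by blast
qed

text \<open>Each node is split off by one divided difference, and the factors
  \<open>1 / real (Suc k)\<close> accumulate to the reciprocal factorial. Since divided differences
  remain smooth at their node, \<open>ys\<close> may contain repetitions; doubled nodes are used for
  the cosine. The alternative \<open>p = 0\<close> covers the empty list, as the zero polynomial has
  degree 0.\<close>

lemma polynomial_interpolation_bound:
  fixes g :: "nat \<Rightarrow> real \<Rightarrow> real"
  assumes "\<And>k x. (g k has_real_derivative g (Suc k) x) (at x)"
    and "\<And>k x. \<bar>g k x\<bar> \<le> B k"
  shows "\<exists>p. (p = 0 \<or> degree p < length ys) \<and>
    (\<forall>x. \<bar>g 0 x - poly p x\<bar> \<le> B (length ys) / fact (length ys) * \<bar>\<Prod>y\<leftarrow>ys. x - y\<bar>)"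
  using assms
proof (induction ys arbitrary: g B)
  case Nil
  then show ?case by (intro exI[of _ 0]) simp
next
  case (Cons y ys)
  obtain G :: "nat \<Rightarrow> real \<Rightarrow> real"
    where G: "\<And>k x. (G k has_real_derivative G (Suc k) x) (at x)"
      "\<And>k x. \<bar>G k x\<bar> \<le> B (Suc k) / real (Suc k)"
      and g: "\<And>x. g 0 x = g 0 y + (x - y) * G 0 x"
    using divided_difference_smooth[where g = g and B = B and y = y] Cons.prems by metis
  from Cons.IH[of G "\<lambda>k. B (Suc k) / real (Suc k)", OF G] obtain q where q: "q = 0 \<or> degree q < length ys"
    "\<And>x. \<bar>G 0 x - poly q x\<bar> \<le>
      B (Suc (length ys)) / real (Suc (length ys)) / fact (length ys) * \<bar>\<Prod>y\<leftarrow>ys. x - y\<bar>"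
    by auto
  define p where "p = [:g 0 y:] + [:- y, 1:] * q"
  have "degree p \<le> max (degree [:g 0 y:]) (degree ([:- y, 1:] * q))"
    unfolding p_def by (rule degree_add_le_max)
  also have "\<dots> < length (y # ys)"
    using q(1) degree_mult_le[of "[:- y, 1:]" q] by auto
  finally have "degree p < length (y # ys)" .
  moreover have "\<bar>g 0 x - poly p x\<bar> \<le>
      B (length (y # ys)) / fact (length (y # ys)) * \<bar>\<Prod>y\<leftarrow>y # ys. x - y\<bar>" for x
  proof -
    have "g 0 x - poly p x = (x - y) * (G 0 x - poly q x)"
      unfolding p_def by (subst g) (simp add: algebra_simps)
    then have "\<bar>g 0 x - poly p x\<bar> = \<bar>x - y\<bar> * \<bar>G 0 x - poly q x\<bar>"
      by (simp add: abs_mult)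
    also have "\<dots> \<le> \<bar>x - y\<bar> * (B (Suc (length ys)) / real (Suc (length ys)) / fact (length ys)
        * \<bar>\<Prod>y\<leftarrow>ys. x - y\<bar>)"
      by (intro mult_left_mono q(2)) simp
    finally show ?thesis
      by (simp add: abs_mult mult_ac)
  qed
  ultimately show ?case by blast
qed

section \<open>Real zeros of Hermite polynomials of lower degree\<close>

text \<open>Rolle's theorem between consecutive zeros, adding the zeros in increasing order. The
  clause \<open>x < Max S\<close> ensures that the zero found in the next gap differs from those
  already in \<open>T\<close>.\<close>

lemma rolle_poly_set:
  fixes p :: "real poly"
  assumes "finite S" "S \<noteq> {}" "\<And>x. x \<in> S \<Longrightarrow> poly p x = 0"
  shows "\<exists>T. finite T \<and> (\<forall>x\<in>T. poly (pderiv p) x = 0 \<and> x < Max S) \<and> card S = Suc (card T)"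
  using assms
proof (induction S rule: finite_linorder_max_induct)
  case (insert b A)
  show ?case
  proof (cases "A = {}")
    case True
    then show ?thesis by (intro exI[of _ "{}"]) simp
  next
    case False
    with insert obtain T where T: "finite T" "\<forall>x\<in>T. poly (pderiv p) x = 0 \<and> x < Max A"
      "card A = Suc (card T)"
      by auto
    have Max: "Max A \<in> A" "Max A < b"
      using False insert by auto
    obtain z where z: "Max A < z" "z < b" "poly (pderiv p) z = 0"
      using poly_MVT[of "Max A" b p] Max insert.prems by auto
    have "Max (insert b A) = b"
      using insert.hyps by (intro Max_eqI) auto
    with T z insert.hyps show ?thesis
      by (intro exI[of _ "insert z T"]) (auto simp: card_insert_if)
  qed
qed simp

text \<open>The assumption makes the zero sets of \<open>p\<close> and of \<open>pderiv p\<close>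
  finite, so that \<open>card\<close> counts them.\<close>

lemma card_roots_pderiv:
  fixes p :: "real poly"
  assumes "pderiv p \<noteq> 0"
  shows "card {x. poly p x = 0} \<le> Suc (card {x. poly (pderiv p) x = 0})"
proof (cases "{x. poly p x = 0} = {}")
  case False
  from assms have "p \<noteq> 0" by auto
  then obtain T where T: "finite T" "\<forall>x\<in>T. poly (pderiv p) x = 0"
    "card {x. poly p x = 0} = Suc (card T)"
    using rolle_poly_set[of "{x. poly p x = 0}" p] False poly_roots_finite by fastforce
  moreover have "card T \<le> card {x. poly (pderiv p) x = 0}"
    using T assms by (intro card_mono poly_roots_finite) auto
  ultimately show ?thesis by simp
next
  case True
  then show ?thesis by (simp only: card.empty)
qed

lemma hermite_nonzero: "hermite n \<noteq> 0"
  using hermite_degree[of n] by auto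

text \<open>The quadrature rule supplies \<open>m\<close> distinct real zeros for degree
  \<open>m\<close> only, while the interpolation nodes are zeros of lower degrees. Since
  \<open>pderiv (hermite (Suc n))\<close> is a nonzero multiple of \<open>hermite n\<close>, Rolle
  loses at most one zero per step down from \<open>m\<close>; the degree bounds the number from
  above.\<close>

lemma card_hermite_roots_mono:
  assumes "card {x. poly (hermite m) x = 0} = m" "n \<le> m"
  shows "card {x. poly (hermite n) x = 0} = n"
  using assms(2)
proof (induction rule: inc_induct)
  case (step n)
  have pd: "pderiv (hermite (Suc n)) = Polynomial.smult (2 * real (Suc n)) (hermite n)"
    by (rule pderiv_hermite)
  have "pderiv (hermite (Suc n)) \<noteq> 0"
    unfolding pd using hermite_nonzero by (simp del: hermite.simps)
  from card_roots_pderiv[OF this] step.IH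
  have "n \<le> card {x. poly (hermite n) x = 0}"
    unfolding pd by simp
  moreover have "card {x. poly (hermite n) x = 0} \<le> n"
    using card_poly_roots_bound[OF hermite_nonzero, of n] hermite_degree[of n] by simp
  ultimately show ?case by simp
qed (fact assms(1))

lemma hermite_factorization:
  assumes "card {x. poly (hermite n) x = 0} = n"
  obtains xs where "length xs = n" "\<And>x. poly (hermite n) x = 2 ^ n * (\<Prod>y\<leftarrow>xs. x - y)"
proof -
  let ?S = "{x. poly (hermite n) x = 0}"
  have fin: "finite ?S"
    using hermite_nonzero by (rule poly_roots_finite)
  define xs where "xs = sorted_list_of_set ?S"
  have len: "length xs = n" and set: "set xs = ?S"
    using assms fin by (simp_all add: xs_def)
  define q where "q = Polynomial.smult (2 ^ n) (\<Prod>y\<leftarrow>xs. [:- y, 1:])"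
  have deg: "degree (\<Prod>y\<leftarrow>ys. [:- y, 1:]) = length ys \<and> lead_coeff (\<Prod>y\<leftarrow>ys. [:- y, 1:]) = 1"
    for ys :: "real list"
  proof (induction ys)
    case (Cons y ys)
    then have "(\<Prod>y\<leftarrow>ys. [:- y, 1:]) \<noteq> 0" by auto
    then have "degree (\<Prod>y\<leftarrow>y # ys. [:- y, 1:]) = Suc (length ys)"
      using Cons unfolding list.map prod_list.Cons by (subst degree_mult_eq) auto
    moreover have "lead_coeff (\<Prod>y\<leftarrow>y # ys. [:- y, 1:]) = 1"
      unfolding list.map prod_list.Cons lead_coeff_mult conjunct2[OF Cons.IH] by simp
    ultimately show ?case by (metis length_Cons)
  qed simp
  have poly_q: "poly q x = 2 ^ n * (\<Prod>y\<leftarrow>xs. x - y)" for x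
  proof -
    have "poly (\<Prod>y\<leftarrow>ys. [:- y, 1:]) x = (\<Prod>y\<leftarrow>ys. x - y)" for ys
      by (induction ys) (auto simp: algebra_simps)
    then show ?thesis by (simp add: q_def)
  qed
  have coeff_h: "degree (hermite n) = n" "coeff (hermite n) n = 2 ^ n"
    using hermite_degree[of n] by metis+
  have coeff_q: "degree q = n" "coeff q n = 2 ^ n"
    using deg[of xs] len unfolding q_def
    by (metis degree_smult_eq power_not_zero zero_neq_numeral, metis coeff_smult mult.right_neutral)
  have "hermite n = q"
  \<comment> \<open>The leading coefficients cancel, so the difference has degree below
    \<open>n\<close> or vanishes, and it has the \<open>n\<close> zeros in
    \<open>?S\<close>.\<close>
  proof (rule poly_eqI_degree_lead_coeff[where n = n and A = ?S])
    show "coeff (hermite n) n = coeff q n"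
      unfolding coeff_h coeff_q ..
    show "poly (hermite n) z = poly q z" if "z \<in> ?S" for z
      using that unfolding set[symmetric] poly_q
      by (auto simp: prod_list_zero_iff set)
  qed (simp_all only: assms coeff_h coeff_q order_refl)
  with that[OF len] poly_q show ?thesis by simp
qed

section \<open>Gaussian integrals of Hermite squares\<close>

definition gauss_integral :: "real poly \<Rightarrow> real" where
  "gauss_integral p = (LINT x|lborel. exp (- x\<^sup>2) * poly p x)"

lemma gauss_integral_add: "gauss_integral (p + q) = gauss_integral p + gauss_integral q"
  unfolding gauss_integral_def
  by (simp add: distrib_left integrable_gauss_poly Bochner_Integration.integral_add)

lemma gauss_integral_smult: "gauss_integral (Polynomial.smult c p) = c * gauss_integral p"
  unfolding gauss_integral_def by (simp add: mult.left_commute[of _ c])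

text \<open>Integration by parts: the factor \<open>[:0, 2:]\<close> in the raising formula
  \<open>step\<close> turns into a derivative of the whole product, and the part falling on
  \<open>hermite n\<close> cancels. Iterating this evaluates the norms.\<close>

lemma gauss_integral_hermite_Suc:
  "gauss_integral (hermite (Suc n) * q) = gauss_integral (hermite n * pderiv q)"
proof -
  have step: "hermite (Suc n) = [:0, 2:] * hermite n - pderiv (hermite n)"
    using pderiv_hermite[of "n - 1"] by (cases n) (auto simp: pderiv_1)
  have "gauss_integral (hermite (Suc n) * q) + gauss_integral (pderiv (hermite n) * q) =
      gauss_integral ([:0, 2:] * (hermite n * q))"
    unfolding step gauss_integral_add[symmetric] by (simp only: algebra_simps) simp
  also have "\<dots> = gauss_integral (pderiv (hermite n * q))"
    unfolding gauss_integral_def by (rule gauss_integral_poly_parts)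
  also have "\<dots> = gauss_integral (hermite n * pderiv q) + gauss_integral (pderiv (hermite n) * q)"
    unfolding gauss_integral_add[symmetric] by (simp add: pderiv_mult mult.commute add.commute)
  finally show ?thesis by simp
qed

lemma gauss_integral_hermite_square:
  "gauss_integral (hermite n * hermite n) = sqrt pi * 2 ^ n * fact n"
proof (induction n)
  case 0
  then show ?case
    using gauss_moment_even[of 0] by (simp add: gauss_integral_def has_bochner_integral_iff)
next
  case (Suc n)
  show ?case
    unfolding gauss_integral_hermite_Suc pderiv_hermite mult_smult_right gauss_integral_smult Suc
    by simp
qed

text \<open>The three-term recurrence expands \<open>[:0, 2:] * hermite n\<close> in the Hermite
  polynomials of the neighbouring degrees; the cross term vanishes by orthogonality and two known
  norms remain. The factor x comes from differentiating the features.\<close>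

lemma gauss_integral_x_hermite_square:
  "gauss_integral ([:0, 2:] * hermite n * ([:0, 2:] * hermite n)) =
    sqrt pi * 2 ^ Suc n * fact n * (2 * real n + 1)"
proof (cases n)
  case 0
  then show ?thesis
    using gauss_integral_hermite_square[of 1] by simp
next
  case (Suc k)
  let ?c = "2 * real (Suc k)"
  have orth: "gauss_integral (hermite (Suc (Suc k)) * hermite k) = 0"
    using hermite_orthogonal[of "hermite k" "Suc (Suc k)"] hermite_degree[of k]
    by (simp add: gauss_integral_def del: hermite.simps)
  have "[:0, 2:] * hermite n = hermite (Suc (Suc k)) + Polynomial.smult ?c (hermite k)"
    unfolding Suc hermite.simps(3) by simp
  moreover have "(p + Polynomial.smult c q) * (p + Polynomial.smult c q) =
      p * p + Polynomial.smult (2 * c) (p * q) + Polynomial.smult (c * c) (q * q)"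
    for p q :: "real poly" and c
    by (simp add: poly_eq_poly_eq_iff[symmetric] fun_eq_iff algebra_simps)
  ultimately have "[:0, 2:] * hermite n * ([:0, 2:] * hermite n) =
      hermite (Suc (Suc k)) * hermite (Suc (Suc k)) +
      Polynomial.smult (2 * ?c) (hermite (Suc (Suc k)) * hermite k) +
      Polynomial.smult (?c * ?c) (hermite k * hermite k)"
    by (simp only:)
  then have "gauss_integral ([:0, 2:] * hermite n * ([:0, 2:] * hermite n)) =
      sqrt pi * 2 ^ Suc (Suc k) * fact (Suc (Suc k)) + ?c * ?c * (sqrt pi * 2 ^ k * fact k)"
    by (simp only: gauss_integral_add gauss_integral_smult orth gauss_integral_hermite_square)
  also have "\<dots> = sqrt pi * 2 ^ Suc n * fact n * (2 * real n + 1)"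
    unfolding Suc by (simp add: algebra_simps)
  finally show ?thesis .
qed

section \<open>Quadrature error by polynomial domination\<close>

lemma degree_square_le: "degree p \<le> n \<Longrightarrow> degree (p * p) \<le> 2 * n"
  for p :: "'a::comm_semiring_0 poly"
  using degree_mult_le[of p p] by simp

lemma gauss_hermite_card_roots:
  assumes "gauss_hermite m \<omega> W"
  shows "card {x. poly (hermite m) x = 0} = m"
  using assms bij_betw_same_card[of \<omega> "{..<m}"] unfolding gauss_hermite_def by auto

text \<open>The rule and the Gaussian integral are both monotone and agree on \<open>s\<close> and
  \<open>r\<close>. Each moves by at most \<open>gauss_integral r\<close> when \<open>f\<close>
  replaces \<open>s\<close>, hence the factor 2.\<close>

lemma gauss_quadrature_error:
  assumes gh: "gauss_hermite m \<omega> W"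
    and deg: "degree s \<le> 2 * m - 1" "degree r \<le> 2 * m - 1"
    and bound: "\<And>x. \<bar>f x - poly s x\<bar> \<le> poly r x"
    and [measurable]: "f \<in> borel_measurable borel"
  shows "integrable lborel (\<lambda>x. exp (- x\<^sup>2) * f x)"
    and "\<bar>quad m \<omega> W f - (LINT x|lborel. exp (- x\<^sup>2) * f x)\<bar> \<le> 2 * gauss_integral r"
proof -
  have W: "W k > 0" if "k < m" for k
    using gh that unfolding gauss_hermite_def by blast
  have exact: "quad m \<omega> W (poly p) = gauss_integral p" if "degree p \<le> 2 * m - 1" for p
    using gh that unfolding gauss_hermite_def gauss_integral_def by blast
  have [measurable]: "poly p \<in> borel_measurable borel" for p :: "real poly"
    by (intro borel_measurable_continuous_onI continuous_on_poly continuous_on_id)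
  have meas: "(\<lambda>x. exp (- x\<^sup>2) * (f x - poly s x)) \<in> borel_measurable lborel"
    by measurable
  have le: "\<bar>exp (- x\<^sup>2) * (f x - poly s x)\<bar> \<le> exp (- x\<^sup>2) * poly r x" for x
    using bound[of x] by (simp add: abs_mult)
  have int_diff: "integrable lborel (\<lambda>x. exp (- x\<^sup>2) * (f x - poly s x))"
    using integrable_gauss_poly[of r] meas 
    by (rule Bochner_Integration.integrable_bound)
      (unfold real_norm_def, intro AE_I2 order_trans[OF le abs_ge_self])
  have "integrable lborel (\<lambda>x. exp (- x\<^sup>2) * (f x - poly s x) + exp (- x\<^sup>2) * poly s x)"
    using int_diff integrable_gauss_poly by (rule Bochner_Integration.integrable_add)
  then show int_f: "integrable lborel (\<lambda>x. exp (- x\<^sup>2) * f x)"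
    by (simp add: distrib_left[symmetric])
  have "\<bar>LINT x|lborel. exp (- x\<^sup>2) * (f x - poly s x)\<bar> \<le> gauss_integral r"
    unfolding gauss_integral_def real_norm_def[symmetric]
    by (rule Bochner_Integration.integral_norm_bound_integral[OF int_diff integrable_gauss_poly]) (use le in simp)
  moreover have "(LINT x|lborel. exp (- x\<^sup>2) * (f x - poly s x)) =
      (LINT x|lborel. exp (- x\<^sup>2) * f x) - gauss_integral s"
    unfolding gauss_integral_def right_diff_distrib
    by (rule Bochner_Integration.integral_diff[OF int_f integrable_gauss_poly])
  \<comment> \<open>This is where the positivity of the weights is used.\<close>
  moreover have "\<bar>quad m \<omega> W f - quad m \<omega> W (poly s)\<bar> \<le> quad m \<omega> W (poly r)"
    unfolding quad_def sum_subtractf[symmetric] right_diff_distrib[symmetric]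
    by (intro order_trans[OF sum_abs] sum_mono)
      (auto simp: abs_mult abs_of_pos[OF W] intro!: mult_left_mono bound less_imp_le[OF W])
  ultimately show "\<bar>quad m \<omega> W f - (LINT x|lborel. exp (- x\<^sup>2) * f x)\<bar> \<le> 2 * gauss_integral r"
    using exact deg by simp
qed

text \<open>Each derivative multiplies by \<open>a\<close> and shifts the phase by
  \<open>pi / 2\<close>, so the k-th one is bounded by \<open>\<bar>a\<bar> ^ k\<close>. The free
  phase \<open>b\<close> also covers the cosine, at \<open>b = pi / 2\<close>.\<close>

lemma trig_interpolation:
  fixes a b :: real
  shows "\<exists>p. (p = 0 \<or> degree p < length ys) \<and>
    (\<forall>x. \<bar>sin (a * x + b) - poly p x\<bar> \<le> \<bar>a\<bar> ^ length ys / fact (length ys) * \<bar>\<Prod>y\<leftarrow>ys. x - y\<bar>)"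
proof -
  define g where "g k x = a ^ k * sin (a * x + (b + real k * pi / 2))" for k x
  have "(g k has_real_derivative g (Suc k) x) (at x)" for k x
  proof -
    have "a * x + (b + real (Suc k) * pi / 2) = a * x + (b + real k * pi / 2) + pi / 2"
      by (simp add: field_simps)
    then have "sin (a * x + (b + real (Suc k) * pi / 2)) = cos (a * x + (b + real k * pi / 2))"
      by (simp only: sin_add) simp
    then show ?thesis
      unfolding g_def by (auto intro!: derivative_eq_intros)
  qed
  moreover have "\<bar>g k x\<bar> \<le> \<bar>a\<bar> ^ k" for k x
    by (simp add: g_def abs_mult power_abs mult_left_le)
  ultimately show ?thesis
    using polynomial_interpolation_bound[of g "\<lambda>k. \<bar>a\<bar> ^ k" ys] by (simp add: g_def)
qed

text \<open>The node polynomial times x splits into the monic multiple of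
  \<open>hermite (Suc k)\<close> and x times that of \<open>hermite k\<close>, both of degree
  \<open>Suc k\<close>. The arithmetic-geometric mean inequality replaces their product by squares,
  giving a nonnegative dominating polynomial of degree at most 2k + 2, within the exactness range 2k
  + 3.\<close>

lemma quad_x_sin_error:
  assumes gh: "gauss_hermite (Suc (Suc k)) \<omega> W"
  shows "\<bar>quad (Suc (Suc k)) \<omega> W (\<lambda>x. x * sin (a * x)) -
      (LINT x|lborel. exp (- x\<^sup>2) * (x * sin (a * x)))\<bar>
    \<le> 3 * sqrt pi * fact (Suc k) / 2 ^ Suc k * \<bar>a\<bar> ^ (2 * k + 1) / fact (2 * k + 1)"
proof -
  let ?m = "Suc (Suc k)"
  note card = card_hermite_roots_mono[OF gauss_hermite_card_roots[OF gh]]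
  from card[of k] obtain xs where xs: "length xs = k"
    "\<And>x. poly (hermite k) x = 2 ^ k * (\<Prod>y\<leftarrow>xs. x - y)"
    using hermite_factorization[of k] by auto
  from card[of "Suc k"] obtain ys where ys: "length ys = Suc k"
    "\<And>x. poly (hermite (Suc k)) x = 2 ^ Suc k * (\<Prod>y\<leftarrow>ys. x - y)"
    using hermite_factorization[of "Suc k"] by auto
  have len: "length (xs @ ys) = 2 * k + 1"
    using xs ys by simp
  define C where "C = \<bar>a\<bar> ^ (2 * k + 1) / fact (2 * k + 1)"
  have C: "C \<ge> 0" by (simp add: C_def)
  obtain p where p: "p = 0 \<or> degree p < 2 * k + 1"
    "\<And>x. \<bar>sin (a * x) - poly p x\<bar> \<le> C * \<bar>\<Prod>y\<leftarrow>xs @ ys. x - y\<bar>"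
    using trig_interpolation[where ys = "xs @ ys" and a = a and b = 0] unfolding len C_def by auto
  \<comment> \<open>\<open>hermite (Suc k)\<close> and \<open>[:0, 2:] * hermite k\<close> both have
    leading coefficient \<open>2 ^ Suc k\<close>, so their squares carry \<open>4 ^ Suc k\<close>;
    the further 2 is from the mean inequality.\<close>
  define r where "r = Polynomial.smult (C / (2 * 4 ^ Suc k))
    (hermite (Suc k) * hermite (Suc k) + [:0, 2:] * hermite k * ([:0, 2:] * hermite k))"
  have "degree ([:0, 2:] * hermite k) \<le> Suc k"
    using degree_mult_le[of "[:0, 2:]" "hermite k"] hermite_degree[of k] by simp
  from degree_square_le[OF this]
  have "degree ([:0, 2:] * hermite k * ([:0, 2:] * hermite k)) \<le> 2 * ?m - 1"
    by (rule order_trans) simp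
  moreover have "degree (hermite (Suc k) * hermite (Suc k)) \<le> 2 * ?m - 1"
    using degree_square_le[of "hermite (Suc k)" "Suc k"] hermite_degree[of "Suc k"] by auto
  ultimately have deg_r: "degree r \<le> 2 * ?m - 1"
    unfolding r_def by (intro order_trans[OF degree_smult_le] degree_add_le)
  have deg_s: "degree ([:0, 1:] * p) \<le> 2 * ?m - 1"
    using degree_mult_le[of "[:0, 1:]" p] p(1) by auto
  have bound: "\<bar>x * sin (a * x) - poly ([:0, 1:] * p) x\<bar> \<le> poly r x" for x
  proof -
    let ?u = "\<Prod>y\<leftarrow>ys. x - y" and ?v = "x * (\<Prod>y\<leftarrow>xs. x - y)"
    have "\<bar>x * sin (a * x) - poly ([:0, 1:] * p) x\<bar> = \<bar>x\<bar> * \<bar>sin (a * x) - poly p x\<bar>"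
      by (simp add: abs_mult right_diff_distrib[symmetric])
    also have "\<dots> \<le> \<bar>x\<bar> * (C * \<bar>\<Prod>y\<leftarrow>xs @ ys. x - y\<bar>)"
      by (intro mult_left_mono p(2)) simp
    also have "\<dots> = C * (\<bar>?u\<bar> * \<bar>?v\<bar>)"
      by (simp add: abs_mult)
    also have "\<bar>?u\<bar> * \<bar>?v\<bar> \<le> (?u\<^sup>2 + ?v\<^sup>2) / 2"
      using sum_squares_bound[of "\<bar>?u\<bar>" "\<bar>?v\<bar>"] by simp
    also have "C * ((?u\<^sup>2 + ?v\<^sup>2) / 2) = poly r x"
      unfolding r_def poly_smult poly_add poly_mult xs ys
      by (simp add: power2_eq_square divide_simps power_mult_distrib[symmetric])
        (simp add: algebra_simps power_mult_distrib[symmetric] power2_eq_square)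
    finally show ?thesis using C by (simp add: mult_left_mono)
  qed
  have "gauss_integral r = C / (2 * 4 ^ Suc k) *
    (sqrt pi * 2 ^ Suc k * fact (Suc k) + sqrt pi * 2 ^ Suc k * fact k * (2 * real k + 1))"
    unfolding r_def gauss_integral_smult gauss_integral_add gauss_integral_hermite_square
      gauss_integral_x_hermite_square by simp
  also have "\<dots> = C * sqrt pi * fact k * (3 * real k + 2) / 2 / 2 ^ Suc k"
  proof -
    have "(4::real) ^ Suc k = 2 ^ Suc k * 2 ^ Suc k"
      by (simp add: power_mult_distrib[symmetric])
    then show ?thesis by (simp add: field_simps del: power_Suc)
  qed
  \<comment> \<open>Rounding 3k + 2 up to 3(k + 1) lets \<open>fact k\<close> become
    \<open>fact (Suc k)\<close>.\<close>
  also have "\<dots> \<le> C * sqrt pi * fact k * (3 * real k + 3) / 2 / 2 ^ Suc k"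
    using C by (intro divide_right_mono mult_left_mono) auto
  finally have "2 * gauss_integral r \<le> 3 * sqrt pi * fact (Suc k) / 2 ^ Suc k * C"
    by (simp add: field_simps)
  moreover have "(\<lambda>x::real. x * sin (a * x)) \<in> borel_measurable borel"
    by measurable
  ultimately show ?thesis
    using gauss_quadrature_error(2)[OF gh deg_s deg_r bound] by (simp add: C_def)
qed

text \<open>Doubling every node makes the node polynomial a square, so its product with x squared is
  already nonnegative and serves as the dominating polynomial without any further
  inequality.\<close>

lemma quad_x2_cos_error:
  assumes gh: "gauss_hermite (Suc (Suc k)) \<omega> W"
  shows "\<bar>quad (Suc (Suc k)) \<omega> W (\<lambda>x. x\<^sup>2 * cos (a * x)) -
      (LINT x|lborel. exp (- x\<^sup>2) * (x\<^sup>2 * cos (a * x)))\<bar>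
    \<le> sqrt pi * fact k * (2 * real k + 1) / 2 ^ k * \<bar>a\<bar> ^ (2 * k) / fact (2 * k)"
proof -
  let ?m = "Suc (Suc k)"
  note card = card_hermite_roots_mono[OF gauss_hermite_card_roots[OF gh]]
  from card[of k] obtain xs where xs: "length xs = k"
    "\<And>x. poly (hermite k) x = 2 ^ k * (\<Prod>y\<leftarrow>xs. x - y)"
    using hermite_factorization[of k] by auto
  have len: "length (xs @ xs) = 2 * k"
    using xs by simp
  define C where "C = \<bar>a\<bar> ^ (2 * k) / fact (2 * k)"
  obtain p where p: "p = 0 \<or> degree p < 2 * k"
    "\<And>x. \<bar>cos (a * x) - poly p x\<bar> \<le> C * \<bar>\<Prod>y\<leftarrow>xs @ xs. x - y\<bar>"
    using trig_interpolation[where ys = "xs @ xs" and a = a and b = "pi / 2"]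
    unfolding len C_def by (auto simp: sin_add)
  define r where "r = Polynomial.smult (C / 4 ^ Suc k) ([:0, 2:] * hermite k * ([:0, 2:] * hermite k))"
  have "degree ([:0, 2:] * hermite k) \<le> Suc k"
    using degree_mult_le[of "[:0, 2:]" "hermite k"] hermite_degree[of k] by simp
  from degree_square_le[OF this]
  have "degree ([:0, 2:] * hermite k * ([:0, 2:] * hermite k)) \<le> 2 * ?m - 1"
    by (rule order_trans) simp
  then have deg_r: "degree r \<le> 2 * ?m - 1"
    unfolding r_def by (intro order_trans[OF degree_smult_le])
  have deg_s: "degree ([:0, 0, 1:] * p) \<le> 2 * ?m - 1"
    using degree_mult_le[of "[:0, 0, 1:]" p] p(1) by auto
  have bound: "\<bar>x\<^sup>2 * cos (a * x) - poly ([:0, 0, 1:] * p) x\<bar> \<le> poly r x" for x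
  proof -
    let ?v = "x * (\<Prod>y\<leftarrow>xs. x - y)"
    have "x\<^sup>2 * cos (a * x) - poly ([:0, 0, 1:] * p) x = x\<^sup>2 * (cos (a * x) - poly p x)"
      by (simp add: algebra_simps power2_eq_square)
    then have "\<bar>x\<^sup>2 * cos (a * x) - poly ([:0, 0, 1:] * p) x\<bar> = x\<^sup>2 * \<bar>cos (a * x) - poly p x\<bar>"
      by (simp add: abs_mult)
    also have "\<dots> \<le> x\<^sup>2 * (C * \<bar>\<Prod>y\<leftarrow>xs @ xs. x - y\<bar>)"
      by (intro mult_left_mono p(2)) simp
    also have "\<dots> = C * (?v * ?v)"
      by (simp add: abs_mult power2_eq_square)
    also have "\<dots> = poly r x"
    proof -
      have "(4::real) ^ Suc k = 4 * 2 ^ k * 2 ^ k"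
        by (simp add: power_mult_distrib[symmetric])
      then show ?thesis
        unfolding r_def poly_smult poly_mult xs by (simp add: field_simps del: power_Suc)
    qed
    finally show ?thesis .
  qed
  have "gauss_integral r = C / 4 ^ Suc k * (sqrt pi * 2 ^ Suc k * fact k * (2 * real k + 1))"
    unfolding r_def gauss_integral_smult gauss_integral_x_hermite_square by simp
  also have "(4::real) ^ Suc k = 2 * 2 ^ k * 2 ^ Suc k"
    by (simp add: power_mult_distrib[symmetric])
  also have "C / (2 * 2 ^ k * 2 ^ Suc k) * (sqrt pi * 2 ^ Suc k * fact k * (2 * real k + 1)) =
      sqrt pi * fact k * (2 * real k + 1) / 2 ^ k * C / 2"
    by (simp add: field_simps)
  finally have "2 * gauss_integral r = sqrt pi * fact k * (2 * real k + 1) / 2 ^ k * C"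
    by simp
  moreover have "(\<lambda>x::real. x\<^sup>2 * cos (a * x)) \<in> borel_measurable borel"
    by measurable
  ultimately show ?thesis
    using gauss_quadrature_error(2)[OF gh deg_s deg_r bound] by (simp add: C_def)
qed

section \<open>Gaussian integrals of trigonometric functions\<close>

lemma integrable_gauss_times:
  fixes f :: "real \<Rightarrow> real"
  assumes [measurable]: "f \<in> borel_measurable borel" and bound: "\<And>x. \<bar>f x\<bar> \<le> c * \<bar>x\<bar> ^ n"
  shows "integrable lborel (\<lambda>x. exp (- x\<^sup>2) * f x)"
proof (rule Bochner_Integration.integrable_bound)
  show "integrable lborel (\<lambda>x. c * (exp (- x\<^sup>2) * x ^ n))"
    by (intro integrable_mult_right integrable_gauss_power)
  have "\<bar>f x\<bar> \<le> \<bar>c * x ^ n\<bar>" for x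
    using bound[of x]
    by (simp add: abs_mult power_abs)
      (metis abs_ge_self abs_ge_zero mult_right_mono order_trans zero_le_power)
  then show "AE x in lborel. norm (exp (- x\<^sup>2) * f x) \<le> norm (c * (exp (- x\<^sup>2) * x ^ n))"
    by (simp add: abs_mult mult.left_commute[of _ "exp _"])
qed measurable

lemma integrable_gauss_trig:
  "integrable lborel (\<lambda>x::real. exp (- x\<^sup>2) * cos (b * x))"
  "integrable lborel (\<lambda>x::real. exp (- x\<^sup>2) * (x * sin (b * x)))"
  "integrable lborel (\<lambda>x::real. exp (- x\<^sup>2) * (x\<^sup>2 * cos (b * x)))"
proof -
  show "integrable lborel (\<lambda>x::real. exp (- x\<^sup>2) * cos (b * x))"
    by (rule integrable_gauss_times[where c = 1 and n = 0]) auto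
  show "integrable lborel (\<lambda>x::real. exp (- x\<^sup>2) * (x * sin (b * x)))"
    by (rule integrable_gauss_times[where c = 1 and n = 1]) (auto simp: abs_mult mult_left_le)
  show "integrable lborel (\<lambda>x::real. exp (- x\<^sup>2) * (x\<^sup>2 * cos (b * x)))"
    by (rule integrable_gauss_times[where c = 1 and n = 2]) (auto simp: abs_mult mult_left_le)
qed

text \<open>Real part of the characteristic function of the standard normal distribution at
  \<open>t = b / sqrt 2\<close>. The substitution of \<open>sqrt 2 * x\<close> turns the density
  into a multiple of \<open>exp (- x\<^sup>2)\<close> and the frequency back into
  \<open>b\<close>.\<close>

lemma gauss_cos_integral:
  "(LINT x|lborel. exp (- x\<^sup>2) * cos (b * x)) = sqrt pi * exp (- b\<^sup>2 / 4)"
proof -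
  define t where "t = b / sqrt 2"
  interpret real_distribution std_normal_distribution
    by (rule real_dist_normal_dist)
  have "integrable std_normal_distribution (\<lambda>x. iexp (t * x))"
    using integrable_iexp[of "\<lambda>x. complex_of_real (t * x)"] by simp
  then have "exp (- t\<^sup>2 / 2) = (LINT x|std_normal_distribution. Re (iexp (t * x)))"
    using char_std_normal_distribution unfolding char_def fun_eq_iff
    by (metis Re_complex_of_real integral_Re)
  also have "\<dots> = (LINT x|std_normal_distribution. cos (t * x))"
    by (simp add: Re_exp)
  also have "\<dots> = (LINT x|lborel. std_normal_density x * cos (t * x))"
    by (subst integral_real_density) (auto intro!: AE_I2)
  also have "\<dots> = sqrt 2 * (LINT x|lborel. std_normal_density (sqrt 2 * x) * cos (t * (sqrt 2 * x)))"
    using lborel_integral_real_affine[of "sqrt 2" "\<lambda>x. std_normal_density x * cos (t * x)" 0] by simp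
  also have "(\<lambda>x. std_normal_density (sqrt 2 * x) * cos (t * (sqrt 2 * x))) =
      (\<lambda>x. (1 / sqrt (2 * pi)) * (exp (- x\<^sup>2) * cos (b * x)))"
    by (auto simp: std_normal_density_def t_def power_mult_distrib)
  also have "(LINT x|lborel. (1 / sqrt (2 * pi)) * (exp (- x\<^sup>2) * cos (b * x))) =
      (1 / sqrt (2 * pi)) * (LINT x|lborel. exp (- x\<^sup>2) * cos (b * x))"
    by (rule integral_mult_right_zero)
  finally show ?thesis
    by (simp add: t_def power_divide real_sqrt_mult field_simps)
qed

text \<open>Replaces integration by parts on the whole line: applied to the derivative of a decaying
  product, it gives a linear relation between the integrals of the terms.\<close>

lemma integral_deriv_eq_0:
  fixes f F :: "real \<Rightarrow> real"
  assumes F: "\<And>x. (F has_real_derivative f x) (at x)"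
    and f: "\<And>x. isCont f x" "integrable lborel f"
    and lim: "(F \<longlongrightarrow> 0) at_bot" "(F \<longlongrightarrow> 0) at_top"
  shows "integral\<^sup>L lborel f = 0"
proof -
  have "(LBINT x=-\<infinity>..\<infinity>. f x) = 0 - 0"
  proof (rule interval_integral_FTC_integrable)
    show "((F \<circ> real_of_ereal) \<longlongrightarrow> 0) (at_right (-\<infinity>))" "((F \<circ> real_of_ereal) \<longlongrightarrow> 0) (at_left \<infinity>)"
      using lim by (auto simp: ereal_tendsto_simps)
  qed (use F f in \<open>auto simp: has_real_derivative_iff_has_vector_derivative set_integrable_def\<close>)
  then show ?thesis
    by (simp add: interval_lebesgue_integral_def set_lebesgue_integral_def)
qed

lemma gauss_decay:
  "((\<lambda>x::real. exp (- x\<^sup>2) * x ^ n) \<longlongrightarrow> 0) at_bot"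
  "((\<lambda>x::real. exp (- x\<^sup>2) * x ^ n) \<longlongrightarrow> 0) at_top"
  by real_asymp+

text \<open>The derivative of \<open>exp (- x\<^sup>2) * sin (b * x)\<close> integrates to 0, which
  reduces the claim to the cosine integral.\<close>

lemma gauss_x_sin_integral:
  "(LINT x|lborel. exp (- x\<^sup>2) * (x * sin (b * x))) = b / 2 * (sqrt pi * exp (- b\<^sup>2 / 4))"
proof -
  let ?c = "\<lambda>x. exp (- x\<^sup>2) * cos (b * x)" and ?s = "\<lambda>x. exp (- x\<^sup>2) * (x * sin (b * x))"
  have lim: "((\<lambda>x. exp (- x\<^sup>2) * sin (b * x)) \<longlongrightarrow> 0) G"
    if "((\<lambda>x::real. exp (- x\<^sup>2) * x ^ 0) \<longlongrightarrow> 0) G" for G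
    by (rule Lim_null_comparison[OF _ that]) (auto simp: abs_mult mult_left_le)
  have int: "integrable lborel (\<lambda>x. b * ?c x)" "integrable lborel (\<lambda>x. 2 * ?s x)"
    by (intro integrable_mult_right integrable_gauss_trig)+
  have "(LINT x|lborel. b * ?c x - 2 * ?s x) = 0"
  proof (rule integral_deriv_eq_0)
    show "((\<lambda>x. exp (- x\<^sup>2) * sin (b * x)) has_real_derivative b * ?c x - 2 * ?s x) (at x)" for x
      by (auto intro!: derivative_eq_intros simp: algebra_simps)
    show "isCont (\<lambda>x. b * ?c x - 2 * ?s x) x" for x
      by (intro continuous_intros)
  qed (intro Bochner_Integration.integrable_diff int lim gauss_decay)+
  then have "b * (LINT x|lborel. ?c x) - 2 * (LINT x|lborel. ?s x) = 0"
    unfolding Bochner_Integration.integral_diff[OF int] integral_mult_right_zero .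
  then show ?thesis
    unfolding gauss_cos_integral by simp
qed

text \<open>As before, now with \<open>exp (- x\<^sup>2) * x * cos (b * x)\<close>, whose derivative
  combines this integrand with the two already evaluated.\<close>

lemma gauss_x2_cos_integral:
  "(LINT x|lborel. exp (- x\<^sup>2) * (x\<^sup>2 * cos (b * x))) = (1 / 2 - b\<^sup>2 / 4) * (sqrt pi * exp (- b\<^sup>2 / 4))"
proof -
  let ?c = "\<lambda>x. exp (- x\<^sup>2) * cos (b * x)" and ?s = "\<lambda>x. exp (- x\<^sup>2) * (x * sin (b * x))"
    and ?d = "\<lambda>x. exp (- x\<^sup>2) * (x\<^sup>2 * cos (b * x))"
  have lim: "((\<lambda>x. exp (- x\<^sup>2) * x * cos (b * x)) \<longlongrightarrow> 0) G"
    if "((\<lambda>x::real. exp (- x\<^sup>2) * x ^ 1) \<longlongrightarrow> 0) G" for G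
    by (rule Lim_null_comparison[OF _ tendsto_rabs_zero[OF that]]) (auto simp: abs_mult mult_left_le)
  have int: "integrable lborel (\<lambda>x. b * ?s x)" "integrable lborel (\<lambda>x. 2 * ?d x)"
    "integrable lborel (\<lambda>x. ?c x - b * ?s x)"
    by (intro Bochner_Integration.integrable_diff integrable_mult_right integrable_gauss_trig)+
  have "(LINT x|lborel. ?c x - b * ?s x - 2 * ?d x) = 0"
  proof (rule integral_deriv_eq_0)
    show "((\<lambda>x. exp (- x\<^sup>2) * x * cos (b * x)) has_real_derivative ?c x - b * ?s x - 2 * ?d x) (at x)" for x
      by (auto intro!: derivative_eq_intros simp: algebra_simps power2_eq_square)
    show "isCont (\<lambda>x. ?c x - b * ?s x - 2 * ?d x) x" for x
      by (intro continuous_intros)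
  qed (intro Bochner_Integration.integrable_diff int lim gauss_decay)+
  then have "(LINT x|lborel. ?c x) - b * (LINT x|lborel. ?s x) - 2 * (LINT x|lborel. ?d x) = 0"
    unfolding Bochner_Integration.integral_diff[OF int(3,2)]
      Bochner_Integration.integral_diff[OF integrable_gauss_trig(1) int(1)] integral_mult_right_zero .
  then show ?thesis
    unfolding gauss_cos_integral gauss_x_sin_integral by (simp add: algebra_simps power2_eq_square)
qed

section \<open>Factorial estimates\<close>

text \<open>Stated for general \<open>j\<close> because induction on \<open>j\<close> only needs \<open>(1 + 1 / q) ^ q \<le> exp 1\<close>,
  whereas a direct induction on \<open>n\<close> for \<open>j = n\<close> needs a sharper estimate.\<close>

lemma fact_add_ge: "real n ^ n * fact (n + j) * exp (real j) \<ge> real (n + j) ^ (n + j) * fact n"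
proof (induction j)
  case (Suc j)
  let ?q = "n + j"
  have "real (Suc ?q) ^ ?q \<le> real ?q ^ ?q * exp 1"
  proof (cases "?q = 0")
    case False
    have "real (Suc ?q) = real ?q * (1 + 1 / real ?q)"
      using False by (simp add: field_simps del: of_nat_add)
    then have "real (Suc ?q) ^ ?q = real ?q ^ ?q * (1 + 1 / real ?q) ^ ?q"
      by (simp only: power_mult_distrib)
    also have "(1 + 1 / real ?q) ^ ?q \<le> exp (1 / real ?q) ^ ?q"
      by (intro power_mono exp_ge_add_one_self) simp
    also have "exp (1 / real ?q) ^ ?q = exp 1"
      using False by (simp add: exp_of_nat_mult[symmetric] del: of_nat_add)
    finally show ?thesis by (simp add: mult_left_mono)
  qed simp
  then have "real (Suc ?q) ^ Suc ?q * fact n \<le> real (Suc ?q) * exp 1 * (real ?q ^ ?q * fact n)"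
    by (simp add: mult_ac mult_left_mono mult_right_mono)
  also have "\<dots> \<le> real (Suc ?q) * exp 1 * (real n ^ n * fact ?q * exp (real j))"
    by (intro mult_left_mono Suc) auto
  also have "\<dots> = real n ^ n * fact (n + Suc j) * exp (real (Suc j))"
    by (simp add: exp_add algebra_simps)
  finally show ?case by simp
qed simp

text \<open>The case \<open>j = n\<close> of \<open>fact_add_ge\<close> after cancelling
  \<open>real n ^ n\<close>. It bounds n! / (2n)! by the n-th power of e / (4n), which is the shape
  of \<open>err\<close>.\<close>

lemma fact_double_ge: "(4 * real n) ^ n * fact n \<le> fact (2 * n) * exp (real n)"
proof (cases "n = 0")
  case False
  have "real n ^ n * ((4 * real n) ^ n * fact n) = real (n + n) ^ (n + n) * fact n"
  proof -
    have "real n * (4 * real n) = real (n + n) * real (n + n)"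
      by simp
    then have "real n ^ n * (4 * real n) ^ n = real (n + n) ^ n * real (n + n) ^ n"
      by (simp only: power_mult_distrib[symmetric])
    then show ?thesis by (simp only: power_add mult.assoc[symmetric])
  qed
  also have "\<dots> \<le> real n ^ n * (fact (2 * n) * exp (real n))"
    using fact_add_ge[of n n] by (simp only: mult_2 mult.assoc)
  finally show ?thesis
    using False by simp
qed simp

section \<open>Kernel derivatives as Gaussian integrals\<close>

lemma kern_deriv:
  "((\<lambda>s. kern l s t) has_real_derivative - ((s - t) / l\<^sup>2 * kern l s t)) (at s)"
  "((\<lambda>t. kern l s t) has_real_derivative (s - t) / l\<^sup>2 * kern l s t) (at t)"
proof -
  \<comment> \<open>With \<open>r\<close> no quotient is left to differentiate, and
    \<open>l = 0\<close> needs no separate case.\<close>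
  define r where "r = 1 / (2 * l\<^sup>2)"
  have kern: "kern l s t = sqrt pi * exp (- (r * (s - t)\<^sup>2))" for s t
    by (simp add: kern_def r_def)
  have r: "(s - t) / l\<^sup>2 = 2 * r * (s - t)"
    by (simp add: r_def)
  show "((\<lambda>s. kern l s t) has_real_derivative - ((s - t) / l\<^sup>2 * kern l s t)) (at s)"
    "((\<lambda>t. kern l s t) has_real_derivative (s - t) / l\<^sup>2 * kern l s t) (at t)"
    unfolding kern r
    by (auto intro!: derivative_eq_intros simp: algebra_simps)
qed

lemma kern_deriv2:
  "((\<lambda>s. deriv (\<lambda>t. kern l s t) t) has_real_derivative (1 / l\<^sup>2 - (s - t)\<^sup>2 / l ^ 4) * kern l s t) (at s)"
proof -
  have "((\<lambda>s. (s - t) / l\<^sup>2) has_real_derivative 1 / l\<^sup>2) (at s)"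
    by (rule DERIV_cdivide) (auto intro!: derivative_eq_intros)
  from DERIV_mult[OF this kern_deriv(1)]
  have "((\<lambda>s. (s - t) / l\<^sup>2 * kern l s t) has_real_derivative
      (1 / l\<^sup>2 - (s - t)\<^sup>2 / l ^ 4) * kern l s t) (at s)"
  proof (rule DERIV_cong)
    have "1 / l\<^sup>2 * K + - (u * K) * u = (1 / l\<^sup>2 - u\<^sup>2) * K" for u K
      by (simp add: algebra_simps power2_eq_square)
    from this[of "kern l s t" "(s - t) / l\<^sup>2"]
    show "1 / l\<^sup>2 * kern l s t + - ((s - t) / l\<^sup>2 * kern l s t) * ((s - t) / l\<^sup>2) =
        (1 / l\<^sup>2 - (s - t)\<^sup>2 / l ^ 4) * kern l s t"
      by (simp add: power_divide del: minus_diff_eq flip: power_mult)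
  qed
  then show ?thesis
    using DERIV_imp_deriv[OF kern_deriv(2)] by simp
qed

lemma scale_square: "(sqrt 2 / l)\<^sup>2 = 2 / l\<^sup>2"
  by (simp add: power_divide)

text \<open>Read with \<open>gauss_cos_integral\<close>, this represents the kernel as the Gaussian
  integral of a cosine of frequency \<open>sqrt 2 / l * (s - t)\<close>.\<close>

lemma gauss_kern:
  "sqrt pi * exp (- (sqrt 2 / l * (s - t))\<^sup>2 / 4) = kern l s t"
  unfolding kern_def power_mult_distrib scale_square by simp

text \<open>The formula is the one that differentiation under the integral sign predicts; the proof
  compares closed forms of both sides instead.\<close>

lemma kern_deriv_integral:
  "deriv (\<lambda>s. kern l s t) s =
    - (sqrt 2 / l) * (LINT x|lborel. exp (- x\<^sup>2) * (x * sin (sqrt 2 / l * (s - t) * x)))"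
proof -
  have "- c * (c * x / 2 * K) = - (c\<^sup>2 / 2 * x * K)" for c x K :: real
    by (simp add: power2_eq_square)
  from this[of "sqrt 2 / l" "s - t" "kern l s t"] show ?thesis
    unfolding DERIV_imp_deriv[OF kern_deriv(1)] gauss_x_sin_integral gauss_kern
    by (simp only: scale_square) simp
qed

lemma kern_deriv2_integral:
  "deriv (\<lambda>s. deriv (\<lambda>t. kern l s t) t) s =
    (sqrt 2 / l)\<^sup>2 * (LINT x|lborel. exp (- x\<^sup>2) * (x\<^sup>2 * cos (sqrt 2 / l * (s - t) * x)))"
proof -
  have "(1 / l\<^sup>2 - x / l ^ 4) * K = 2 / l\<^sup>2 * ((1 / 2 - 2 / l\<^sup>2 * x / 4) * K)" for x K
    by (simp add: algebra_simps power2_eq_square power4_eq_xxxx)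
  then show ?thesis
    unfolding DERIV_imp_deriv[OF kern_deriv2] gauss_x2_cos_integral gauss_kern
    unfolding power_mult_distrib scale_square .
qed

section \<open>Feature products as quadrature sums\<close>

lemma sum_lessThan_double: "(\<Sum>i<2 * m. f i) = (\<Sum>k<m. f (2 * k) + f (2 * k + 1))"
  for f :: "nat \<Rightarrow> 'a::comm_monoid_add"
  by (induction m) (simp_all add: add.assoc)

lemma qff_index:
  assumes "k < m"
  shows "qff m \<omega> W l t $ (2 * k) = sqrt (W k) * cos (\<omega> k * (sqrt 2 / l) * t)"
    and "qff m \<omega> W l t $ (2 * k + 1) = sqrt (W k) * sin (\<omega> k * (sqrt 2 / l) * t)"
    and "qff_deriv m \<omega> W l t $ (2 * k) = - sqrt (W k) * (sqrt 2 / l) * \<omega> k * sin (\<omega> k * (sqrt 2 / l) * t)"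
    and "qff_deriv m \<omega> W l t $ (2 * k + 1) = sqrt (W k) * (sqrt 2 / l) * \<omega> k * cos (\<omega> k * (sqrt 2 / l) * t)"
  using assms unfolding qff_deriv_eq qff_def by simp_all

text \<open>The addition theorems merge the two components of each abscissa into one sine or cosine
  of the difference. The rule is thus applied to the very integrands of
  \<open>kern_deriv_integral\<close> and \<open>kern_deriv2_integral\<close>.\<close>

lemma qff_deriv_scalar_prod:
  assumes "\<forall>k<m. W k \<ge> 0"
  shows "scalar_prod (qff_deriv m \<omega> W l s) (qff m \<omega> W l t) =
      - (sqrt 2 / l) * quad m \<omega> W (\<lambda>x. x * sin (sqrt 2 / l * (s - t) * x))"
    and "scalar_prod (qff_deriv m \<omega> W l s) (qff_deriv m \<omega> W l t) =
      (sqrt 2 / l)\<^sup>2 * quad m \<omega> W (\<lambda>x. x\<^sup>2 * cos (sqrt 2 / l * (s - t) * x))"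
proof -
  define c where "c = sqrt 2 / l"
  have arg: "c * (s - t) * x = x * c * s - x * c * t" for x
    by (simp add: algebra_simps)
  have dim: "dim_vec (qff m \<omega> W l t) = 2 * m" "dim_vec (qff_deriv m \<omega> W l t) = 2 * m"
    by (simp_all add: qff_def qff_deriv_def)
  note simps = scalar_prod_def dim atLeast0LessThan sum_lessThan_double quad_def sum_distrib_left
  show "scalar_prod (qff_deriv m \<omega> W l s) (qff m \<omega> W l t) =
      - (sqrt 2 / l) * quad m \<omega> W (\<lambda>x. x * sin (sqrt 2 / l * (s - t) * x))"
    unfolding simps
  proof (intro sum.cong refl, unfold lessThan_iff)
    fix k assume k: "k < m"
    obtain w where w: "W k = w * w" "sqrt (W k) = w"
      using assms k by (metis real_sqrt_ge_zero real_sqrt_mult_self abs_of_nonneg real_sqrt_mult)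
    show "qff_deriv m \<omega> W l s $ (2 * k) * qff m \<omega> W l t $ (2 * k) +
        qff_deriv m \<omega> W l s $ (2 * k + 1) * qff m \<omega> W l t $ (2 * k + 1) =
        - (sqrt 2 / l) * (W k * (\<omega> k * sin (sqrt 2 / l * (s - t) * \<omega> k)))"
      unfolding qff_index[OF k] c_def[symmetric] arg sin_diff w by (simp add: algebra_simps)
  qed
  show "scalar_prod (qff_deriv m \<omega> W l s) (qff_deriv m \<omega> W l t) =
      (sqrt 2 / l)\<^sup>2 * quad m \<omega> W (\<lambda>x. x\<^sup>2 * cos (sqrt 2 / l * (s - t) * x))"
    unfolding simps
  proof (intro sum.cong refl, unfold lessThan_iff)
    fix k assume k: "k < m"
    obtain w where w: "W k = w * w" "sqrt (W k) = w"
      using assms k by (metis real_sqrt_ge_zero real_sqrt_mult_self abs_of_nonneg real_sqrt_mult)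
    show "qff_deriv m \<omega> W l s $ (2 * k) * qff_deriv m \<omega> W l t $ (2 * k) +
        qff_deriv m \<omega> W l s $ (2 * k + 1) * qff_deriv m \<omega> W l t $ (2 * k + 1) =
        (sqrt 2 / l)\<^sup>2 * (W k * ((\<omega> k)\<^sup>2 * cos (sqrt 2 / l * (s - t) * \<omega> k)))"
      unfolding qff_index[OF k] c_def[symmetric] arg cos_diff w
      by (simp add: algebra_simps power2_eq_square)
  qed
qed

section \<open>Comparison of the error constants with \<open>err\<close>\<close>

lemma err_eq: "err l n = sqrt pi * exp (real n) / (4 ^ n * l ^ (2 * n) * real n ^ n)"
proof -
  have "exp (real n) = exp 1 ^ n"
    using exp_of_nat_mult[of n "1::real"] by simp
  then show ?thesis
    by (simp add: err_def power_divide power_mult_distrib power_mult)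
qed

lemma divide_le_divide_cross:
  fixes a b c d :: "'a::linordered_field"
  assumes "a * d \<le> b * c" "c > 0" "d > 0"
  shows "a / c \<le> b / d"
  using assms by (simp add: field_simps)

text \<open>The powers of \<open>sqrt 2 / l\<close> combine to the power \<open>Suc k\<close> of
  \<open>2 / l\<^sup>2\<close>, whose 2s cancel \<open>2 ^ Suc k\<close>. The remaining factorial
  quotient is handled by \<open>fact_double_ge\<close> at \<open>Suc k\<close>; the excess of
  \<open>Suc k\<close> over \<open>k\<close> leaves the prefactor
  \<open>exp 1 / l\<^sup>2\<close>.\<close>

lemma sin_error_constant_le:
  "sqrt 2 / l * (3 * sqrt pi * fact (Suc k) / 2 ^ Suc k * (sqrt 2 / l) ^ (2 * k + 1) / fact (2 * k + 1))
    \<le> 2 * exp 1 / l\<^sup>2 * err l k"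
proof -
  define A F :: real where "A = fact (Suc k)" and "F = fact (2 * k + 1)"
  have AF: "A > 0" "F > 0" by (simp_all add: A_def F_def)
  have kk: "real k ^ k > 0" by (cases k) auto
  \<comment> \<open>Uses 3 <= 4 and the monotonicity of the power in its base.\<close>
  have "3 * A * (4 ^ k * real k ^ k) \<le> 4 ^ Suc k * real (Suc k) ^ k * A"
  proof -
    have "real k ^ k \<le> real (Suc k) ^ k"
      by (rule power_mono) auto
    then have "A * (3 * 4 ^ k) * real k ^ k \<le> A * (4 * 4 ^ k) * real (Suc k) ^ k"
      using AF by (intro mult_mono) auto
    then show ?thesis by (simp add: mult_ac)
  qed
  moreover have "real (Suc k) * (4 ^ Suc k * real (Suc k) ^ k * A) \<le> real (Suc k) * (2 * exp (real (Suc k)) * F)"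
  proof -
    \<comment> \<open>The extra factor \<open>Suc k\<close> is cancelled against one of those in
      \<open>real (Suc k) ^ Suc k\<close>.\<close>
    have "fact (2 * Suc k) = 2 * real (Suc k) * F"
      by (simp add: F_def algebra_simps)
    with fact_double_ge[of "Suc k"]
    have "(4 * real (Suc k)) ^ Suc k * A \<le> 2 * real (Suc k) * F * exp (real (Suc k))"
      by (simp only: A_def)
    then show ?thesis
      by (simp only: power_mult_distrib power_Suc mult_ac)
  qed
  then have "4 ^ Suc k * real (Suc k) ^ k * A \<le> 2 * exp (real (Suc k)) * F"
    by (rule mult_left_le_imp_le) simp
  ultimately have "3 * A * (4 ^ k * real k ^ k) \<le> 2 * exp (real (Suc k)) * F"
    by (rule order_trans)
  then have key: "3 * A / F \<le> 2 * exp (real (Suc k)) / (4 ^ k * real k ^ k)"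
    using AF kk by (intro divide_le_divide_cross) simp_all
  have "sqrt 2 / l * (3 * sqrt pi * A / 2 ^ Suc k * (sqrt 2 / l) ^ (2 * k + 1) / F) =
      3 * sqrt pi * A / 2 ^ Suc k * ((sqrt 2 / l)\<^sup>2) ^ Suc k / F"
  proof -
    have "(c\<^sup>2) ^ Suc k = c * c ^ (2 * k + 1)" for c :: real
      by (simp add: power_mult power2_eq_square)
    moreover have "c * (B * p / F) = B * (c * p) / F" for B c p
      by simp
    ultimately show ?thesis by (simp only:)
  qed
  also have "3 * sqrt pi * A / 2 ^ Suc k * ((sqrt 2 / l)\<^sup>2) ^ Suc k / F =
      sqrt pi / (l\<^sup>2) ^ Suc k * (3 * A / F)"
    unfolding scale_square by (simp add: power_divide del: power_Suc)
  also have "\<dots> \<le> sqrt pi / (l\<^sup>2) ^ Suc k * (2 * exp (real (Suc k)) / (4 ^ k * real k ^ k))"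
    by (intro mult_left_mono key) simp
  also have "\<dots> = 2 * exp 1 / l\<^sup>2 * err l k"
    unfolding err_eq power_mult[of l 2 k] by (simp add: exp_add mult_ac)
  finally show ?thesis
    unfolding A_def F_def .
qed

text \<open>Again \<open>fact_double_ge\<close> at \<open>Suc j\<close>. One of the factors
  \<open>4 * r\<close> there absorbs \<open>2 * r + 1\<close>, since \<open>r >= 1\<close>, and the
  others dominate the power of \<open>4 * real j\<close>. The 2 in the prefactor comes from the
  square of \<open>sqrt 2 / l\<close>.\<close>

lemma cos_error_constant_le:
  "(sqrt 2 / l)\<^sup>2 * (sqrt pi * fact (Suc j) * (2 * real (Suc j) + 1) / 2 ^ Suc j *
      (sqrt 2 / l) ^ (2 * Suc j) / fact (2 * Suc j))
    \<le> 2 * exp 1 / l ^ 4 * err l j"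
proof -
  define A F r :: real where "A = fact (Suc j)" and "F = fact (2 * Suc j)" and "r = real (Suc j)"
  have AF: "A > 0" "F > 0" by (simp_all add: A_def F_def)
  have jj: "real j ^ j > 0" by (cases j) auto
  have "A * (2 * r + 1) * (4 ^ j * real j ^ j) \<le> (4 * r) ^ Suc j * A"
  proof -
    have "real j ^ j \<le> r ^ j"
      unfolding r_def by (rule power_mono) auto
    moreover have "2 * r + 1 \<le> 4 * r"
      by (simp add: r_def)
    ultimately have "A * (2 * r + 1) * 4 ^ j * real j ^ j \<le> A * (4 * r) * 4 ^ j * r ^ j"
      using AF by (intro mult_mono) (auto simp: r_def)
    then show ?thesis by (simp only: power_mult_distrib power_Suc mult_ac)
  qed
  also have "\<dots> \<le> exp r * F"
    using fact_double_ge[of "Suc j"] unfolding A_def F_def r_def by (simp only: mult.commute)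
  finally have key: "A * (2 * r + 1) / F \<le> exp r / (4 ^ j * real j ^ j)"
    using AF jj by (intro divide_le_divide_cross) auto
  have "(sqrt 2 / l)\<^sup>2 * (sqrt pi * A * (2 * r + 1) / 2 ^ Suc j * (sqrt 2 / l) ^ (2 * Suc j) / F) =
      2 * sqrt pi / (l\<^sup>2 * (l\<^sup>2) ^ Suc j) * (A * (2 * r + 1) / F)"
    by (simp add: power_divide power_mult del: power_Suc mult_Suc_right)
  also have "\<dots> \<le> 2 * sqrt pi / (l\<^sup>2 * (l\<^sup>2) ^ Suc j) * (exp r / (4 ^ j * real j ^ j))"
    by (intro mult_left_mono key) simp
  also have "\<dots> = 2 * exp 1 / l ^ 4 * err l j"
  proof -
    have "4 + 2 * j = 2 + 2 * Suc j" by simp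
    then have "l\<^sup>2 * (l\<^sup>2) ^ Suc j = l ^ 4 * l ^ (2 * j)"
      by (simp only: power_mult[symmetric] power_add[symmetric])
    then show ?thesis
      unfolding err_eq r_def by (simp only:) (simp add: exp_add mult_ac)
  qed
  finally show ?thesis
    unfolding A_def F_def r_def .
qed

text \<open>The guards on \<open>m\<close> keep \<open>m - 2\<close> and \<open>m - 3\<close>
  genuine differences, as subtraction on \<open>nat\<close> truncates.\<close>

theorem theorem2:
  fixes l t\<^sub>i t\<^sub>j :: real and m :: nat and \<omega> W :: "nat \<Rightarrow> real"
  assumes "l > 0"
    and "gauss_hermite m \<omega> W"
    and "\<bar>t\<^sub>i - t\<^sub>j\<bar> \<le> 1"
  shows "(m \<ge> 2 \<longrightarrow>
           \<bar>deriv (\<lambda>s. kern l s t\<^sub>j) t\<^sub>i - scalar_prod (qff_deriv m \<omega> W l t\<^sub>i) (qff m \<omega> W l t\<^sub>j)\<bar>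
             \<le> 2 * exp 1 / l\<^sup>2 * err l (m - 2)) \<and>
         (m \<ge> 3 \<longrightarrow>
           \<bar>deriv (\<lambda>s. deriv (\<lambda>t. kern l s t) t\<^sub>j) t\<^sub>i - scalar_prod (qff_deriv m \<omega> W l t\<^sub>i) (qff_deriv m \<omega> W l t\<^sub>j)\<bar>
             \<le> 2 * exp 1 / l ^ 4 * err l (m - 3))"
proof -
  define c where "c = sqrt 2 / l"
  let ?a = "c * (t\<^sub>i - t\<^sub>j)"
  have c: "c > 0"
    using assms(1) by (simp add: c_def)
  \<comment> \<open>The distance assumption enters here: it bounds the frequency \<open>?a\<close>
    by \<open>c\<close>.\<close>
  have a: "\<bar>?a\<bar> ^ n \<le> c ^ n" for n
    using c assms(3) by (intro power_mono) (auto simp: abs_mult mult_left_le)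
  have W: "\<forall>k<m. W k \<ge> 0"
    using assms(2) unfolding gauss_hermite_def by (simp add: less_imp_le)
  have scale: "\<bar>d * u - d * v\<bar> = \<bar>d\<bar> * \<bar>v - u\<bar>" for d u v :: real
    by (simp only: right_diff_distrib[symmetric] abs_mult abs_minus_commute[of u v])
  have 1: "\<bar>deriv (\<lambda>s. kern l s t\<^sub>j) t\<^sub>i - scalar_prod (qff_deriv m \<omega> W l t\<^sub>i) (qff m \<omega> W l t\<^sub>j)\<bar>
      \<le> 2 * exp 1 / l\<^sup>2 * err l (m - 2)" if "m \<ge> 2"
  proof -
    define k where "k = m - 2"
    have m: "m = Suc (Suc k)"
      using that by (simp add: k_def)
    have "\<bar>deriv (\<lambda>s. kern l s t\<^sub>j) t\<^sub>i - scalar_prod (qff_deriv m \<omega> W l t\<^sub>i) (qff m \<omega> W l t\<^sub>j)\<bar> =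
        \<bar>- c\<bar> * \<bar>quad m \<omega> W (\<lambda>x. x * sin (?a * x)) - (LINT x|lborel. exp (- x\<^sup>2) * (x * sin (?a * x)))\<bar>"
      unfolding kern_deriv_integral qff_deriv_scalar_prod(1)[OF W] c_def[symmetric] by (rule scale)
    also have "\<bar>- c\<bar> = c"
      using c by simp
    also have "\<bar>quad m \<omega> W (\<lambda>x. x * sin (?a * x)) - (LINT x|lborel. exp (- x\<^sup>2) * (x * sin (?a * x)))\<bar> \<le>
        3 * sqrt pi * fact (Suc k) / 2 ^ Suc k * \<bar>?a\<bar> ^ (2 * k + 1) / fact (2 * k + 1)"
      unfolding m by (rule quad_x_sin_error[OF assms(2)[unfolded m]])
    also have "\<dots> \<le> 3 * sqrt pi * fact (Suc k) / 2 ^ Suc k * c ^ (2 * k + 1) / fact (2 * k + 1)"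
      by (intro divide_right_mono mult_left_mono a) auto
    also have "c * \<dots> \<le> 2 * exp 1 / l\<^sup>2 * err l k"
      unfolding c_def by (rule sin_error_constant_le)
    finally show ?thesis
      using c unfolding k_def by (simp add: mult_left_mono)
  qed
  have 2: "\<bar>deriv (\<lambda>s. deriv (\<lambda>t. kern l s t) t\<^sub>j) t\<^sub>i - scalar_prod (qff_deriv m \<omega> W l t\<^sub>i) (qff_deriv m \<omega> W l t\<^sub>j)\<bar>
      \<le> 2 * exp 1 / l ^ 4 * err l (m - 3)" if "m \<ge> 3"
  proof -
    define j where "j = m - 3"
    have m: "m = Suc (Suc (Suc j))"
      using that by (simp add: j_def)
    \<comment> \<open>The error lemma is used at \<open>m - 2 = Suc j\<close>, whereas the bound is
      stated with \<open>err\<close> at \<open>j\<close>; \<open>cos_error_constant_le\<close> makes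
      up for the shift.\<close>
    let ?k = "Suc j"
    have "\<bar>deriv (\<lambda>s. deriv (\<lambda>t. kern l s t) t\<^sub>j) t\<^sub>i - scalar_prod (qff_deriv m \<omega> W l t\<^sub>i) (qff_deriv m \<omega> W l t\<^sub>j)\<bar> =
        \<bar>c\<^sup>2\<bar> * \<bar>quad m \<omega> W (\<lambda>x. x\<^sup>2 * cos (?a * x)) - (LINT x|lborel. exp (- x\<^sup>2) * (x\<^sup>2 * cos (?a * x)))\<bar>"
      unfolding kern_deriv2_integral qff_deriv_scalar_prod(2)[OF W] c_def[symmetric] by (rule scale)
    also have "\<bar>c\<^sup>2\<bar> = c\<^sup>2"
      by simp
    also have "\<bar>quad m \<omega> W (\<lambda>x. x\<^sup>2 * cos (?a * x)) - (LINT x|lborel. exp (- x\<^sup>2) * (x\<^sup>2 * cos (?a * x)))\<bar> \<le>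
        sqrt pi * fact ?k * (2 * real ?k + 1) / 2 ^ ?k * \<bar>?a\<bar> ^ (2 * ?k) / fact (2 * ?k)"
      unfolding m by (rule quad_x2_cos_error[OF assms(2)[unfolded m]])
    also have "\<dots> \<le> sqrt pi * fact ?k * (2 * real ?k + 1) / 2 ^ ?k * c ^ (2 * ?k) / fact (2 * ?k)"
      by (intro divide_right_mono mult_left_mono a) auto
    also have "c\<^sup>2 * \<dots> \<le> 2 * exp 1 / l ^ 4 * err l j"
      unfolding c_def by (rule cos_error_constant_le)
    finally show ?thesis
      unfolding j_def by (simp add: mult_left_mono)
  qed
  from 1 2 show ?thesis by blast
qed

end
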